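(* For $n\ge 2$, $r,s\ge 1$ and $G\in \mathcal G_{2n}(2r+1,2s+1)$, $\chi_{la}(G) = 3$.
   Context: For a graph $G$, a bijection $f:E(G)\to[1,|E(G)|]$ is a local antimagic labeling if $f^+(u)\ne f^+(v)$ for every edge $uv$, where $f^+(u)$ is the sum of the labels of edges incident to $u$; $\chi_{la}(G)$ is the minimum number of distinct induced vertex labels over all local antimagic labelings. Let $2k+1=(2r+1)(2s+1)$, $n\ge 2$, $M=8k+4$, and consider $(2k+1)(P_2\vee O_{2n})$ with vertices $u_i,v_i,x_{i,j}$ and edges $u_iv_i,u_ix_{i,j},v_ix_{i,j}$ ($1\le i\le 2k+1$, $1\le j\le 2n$). Label edges bijectively with $[1,(4n+1)(2k+1)]$ as follows (with $2\le j\le n$ where $j$ appears). For $1\le i\le k+1$: $f(u_ix_{i,2n-2j+1})=k+2-i+jM$, $f(u_ix_{i,2n-2j+2})=-3k-2+i+jM$, $f(u_ix_{i,2n-1})=10k+7-2i$, $f(u_ix_{i,2n})=5k+2+i$, $f(u_iv_i)=i$, $f(v_ix_{i,1})=3k+1+i$, $f(v_ix_{i,2})=8k+6-2i$, $f(v_ix_{i,2j-1})=-5k-3+i+jM$, $f(v_ix_{i,2j})=-k+1-i+jM$. For $k+2\le i\le 2k+1$: $f(u_ix_{i,2n-2j+1})=3k+3-i+jM$, $f(u_ix_{i,2n-2j+2})=-5k-3+i+jM$, $f(u_ix_{i,2n-1})=12k+8-2i$, $f(u_ix_{i,2n})=3k+1+i$, $f(u_iv_i)=i$, $f(v_ix_{i,1})=k+i$,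 $f(v_ix_{i,2})=10k+7-2i$, $f(v_ix_{i,2j-1})=-7k-4+i+jM$, $f(v_ix_{i,2j})=k+2-i+jM$. Then $f^+(u_i)=8n^2k+6nk+4n^2+4n+k+1$, $f^+(v_i)=8n^2k+2nk+4n^2+2n+k+1$. For $j\in[1,2n]$ let $S_j=\{f^+(x_{i,j})\mid 1\le i\le 2k+1\}$: for $j=2,2n-1$ it is an arithmetic sequence from $5k+3+n(8k+4)$ to $3k+3+n(8k+4)$ with common difference $-1$, and for other $j$ every term equals $(4k+3)+n(8k+4)$; each $S_j$ has sum $(2k+1)[(4k+3)+n(8k+4)]$. Each $S_j$ can be partitioned (e.g. via a $(2r+1)\times(2s+1)$ magic rectangle in the non-constant case) into $2r+1$ blocks of size $2s+1$, each with sum $(2s+1)[(4k+3)+n(8k+4)]$; partitions for different $j$ may differ. $\mathcal G_{2n}(2r+1,2s+1)$ is the set of all graphs obtained by choosing such partitions for every $j$ and merging the vertices $x_{i,j}$ in each block into a single vertex of degree $2(2s+1)$. *)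

theory Defs
  imports Main "HOL-Library.Disjoint_Sets"
begin

text \<open>A finite simple graph is a pair of a vertex set and a set of two-element edge sets.\<close>

type_synonym 'a graph = "'a set \<times> 'a set set"

abbreviation verts :: "'a graph \<Rightarrow> 'a set" where
  "verts G \<equiv> fst G"

abbreviation edges :: "'a graph \<Rightarrow> 'a set set" where
  "edges G \<equiv> snd G"

definition induced_label :: "'a graph \<Rightarrow> ('a set \<Rightarrow> nat) \<Rightarrow> 'a \<Rightarrow> nat" where
  "induced_label G f v = (\<Sum>e\<in>{e \<in> edges G. v \<in> e}. f e)"

definition local_antimagic :: "'a graph \<Rightarrow> ('a set \<Rightarrow> nat) \<Rightarrow> bool" where
  "local_antimagic G f \<longleftrightarrow>
     bij_betw f (edges G) {1..card (edges G)} \<and>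
     (\<forall>u v. {u, v} \<in> edges G \<longrightarrow> induced_label G f u \<noteq> induced_label G f v)"

text \<open>The infimum is over a set of naturals, hence a minimum if the set is nonempty;
  it is 0 if there is no local antimagic labeling, so a positive value of \<open>chi_la\<close>
  entails that one exists.\<close>

definition chi_la :: "'a graph \<Rightarrow> nat" where
  "chi_la G = Inf {card (induced_label G f ` verts G) | f. local_antimagic G f}"

definition merge :: "'a graph \<Rightarrow> 'a set set \<Rightarrow> 'a set graph" where
  "merge G C =
     (C, {{A, B} | A B. A \<in> C \<and> B \<in> C \<and> (\<exists>a\<in>A. \<exists>b\<in>B. {a, b} \<in> edges G)})"

datatype vertex = U nat | V nat | X nat nat

text \<open>The graph \<open>(2k+1)(P\<^sub>2 \<or> O\<^sub>2\<^sub>n)\<close>.\<close>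

definition base_graph :: "nat \<Rightarrow> nat \<Rightarrow> vertex graph" where
  "base_graph k n =
     ({U i | i. i \<in> {1..2*k+1}} \<union> {V i | i. i \<in> {1..2*k+1}} \<union>
        {X i j | i j. i \<in> {1..2*k+1} \<and> j \<in> {1..2*n}},
      {{U i, V i} | i. i \<in> {1..2*k+1}} \<union>
        {{U i, X i j} | i j. i \<in> {1..2*k+1} \<and> j \<in> {1..2*n}} \<union>
        {{V i, X i j} | i j. i \<in> {1..2*k+1} \<and> j \<in> {1..2*n}})"

text \<open>The graph of the edge labeling of \<open>base_graph k n\<close> for \<open>n \<ge> 2\<close>. The labels are
  integers so that the subtractions below do not truncate; all of them are positive.\<close>

inductive base_label :: "nat \<Rightarrow> nat \<Rightarrow> vertex set \<Rightarrow> int \<Rightarrow> bool"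
  for k n :: nat where
  uv: "i \<in> {1..2*k+1} \<Longrightarrow>
    base_label k n {U i, V i} (int i)"
| ux_odd: "i \<in> {1..k+1} \<Longrightarrow> j \<in> {2..n} \<Longrightarrow>
    base_label k n {U i, X i (2*n-2*j+1)} (int k + 2 - int i + int j * (8 * int k + 4))"
| ux_even: "i \<in> {1..k+1} \<Longrightarrow> j \<in> {2..n} \<Longrightarrow>
    base_label k n {U i, X i (2*n-2*j+2)} (- 3 * int k - 2 + int i + int j * (8 * int k + 4))"
| ux_penult: "i \<in> {1..k+1} \<Longrightarrow>
    base_label k n {U i, X i (2*n-1)} (10 * int k + 7 - 2 * int i)"
| ux_last: "i \<in> {1..k+1} \<Longrightarrow>
    base_label k n {U i, X i (2*n)} (5 * int k + 2 + int i)"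
| vx_first: "i \<in> {1..k+1} \<Longrightarrow>
    base_label k n {V i, X i 1} (3 * int k + 1 + int i)"
| vx_second: "i \<in> {1..k+1} \<Longrightarrow>
    base_label k n {V i, X i 2} (8 * int k + 6 - 2 * int i)"
| vx_odd: "i \<in> {1..k+1} \<Longrightarrow> j \<in> {2..n} \<Longrightarrow>
    base_label k n {V i, X i (2*j-1)} (- 5 * int k - 3 + int i + int j * (8 * int k + 4))"
| vx_even: "i \<in> {1..k+1} \<Longrightarrow> j \<in> {2..n} \<Longrightarrow>
    base_label k n {V i, X i (2*j)} (- int k + 1 - int i + int j * (8 * int k + 4))"
| ux_odd': "i \<in> {k+2..2*k+1} \<Longrightarrow> j \<in> {2..n} \<Longrightarrow>
    base_label k n {U i, X i (2*n-2*j+1)} (3 * int k + 3 - int i + int j * (8 * int k + 4))"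
| ux_even': "i \<in> {k+2..2*k+1} \<Longrightarrow> j \<in> {2..n} \<Longrightarrow>
    base_label k n {U i, X i (2*n-2*j+2)} (- 5 * int k - 3 + int i + int j * (8 * int k + 4))"
| ux_penult': "i \<in> {k+2..2*k+1} \<Longrightarrow>
    base_label k n {U i, X i (2*n-1)} (12 * int k + 8 - 2 * int i)"
| ux_last': "i \<in> {k+2..2*k+1} \<Longrightarrow>
    base_label k n {U i, X i (2*n)} (3 * int k + 1 + int i)"
| vx_first': "i \<in> {k+2..2*k+1} \<Longrightarrow>
    base_label k n {V i, X i 1} (int k + int i)"
| vx_second': "i \<in> {k+2..2*k+1} \<Longrightarrow>
    base_label k n {V i, X i 2} (10 * int k + 7 - 2 * int i)"
| vx_odd': "i \<in> {k+2..2*k+1} \<Longrightarrow> j \<in> {2..n} \<Longrightarrow>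
    base_label k n {V i, X i (2*j-1)} (- 7 * int k - 4 + int i + int j * (8 * int k + 4))"
| vx_even': "i \<in> {k+2..2*k+1} \<Longrightarrow> j \<in> {2..n} \<Longrightarrow>
    base_label k n {V i, X i (2*j)} (int k + 2 - int i + int j * (8 * int k + 4))"

definition base_labeling :: "nat \<Rightarrow> nat \<Rightarrow> vertex set \<Rightarrow> nat" where
  "base_labeling k n e = nat (THE l. base_label k n e l)"

text \<open>Equal values \<open>f\<^sup>+(x\<^sub>i\<^sub>,\<^sub>j)\<close> for different \<open>i\<close> count separately in the family \<open>S\<^sub>j\<close>,
  so a partition of \<open>S\<^sub>j\<close> is a partition of the index set \<open>{1..2k+1}\<close>.\<close>

definition admissible_partition ::
    "nat \<Rightarrow> nat \<Rightarrow> nat \<Rightarrow> nat \<Rightarrow> nat \<Rightarrow> nat set set \<Rightarrow> bool" where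
  "admissible_partition k n r s j P \<longleftrightarrow>
     partition_on {1..2*k+1} P \<and> card P = 2*r+1 \<and>
     (\<forall>B\<in>P. card B = 2*s+1 \<and>
        (\<Sum>i\<in>B. induced_label (base_graph k n) (base_labeling k n) (X i j)) =
          (2*s+1) * ((4*k+3) + n * (8*k+4)))"

definition merge_classes :: "nat \<Rightarrow> nat \<Rightarrow> (nat \<Rightarrow> nat set set) \<Rightarrow> vertex set set" where
  "merge_classes k n P =
     {{U i} | i. i \<in> {1..2*k+1}} \<union> {{V i} | i. i \<in> {1..2*k+1}} \<union>
     {(\<lambda>i. X i j) ` B | j B. j \<in> {1..2*n} \<and> B \<in> P j}"

text \<open>\<open>merged_graphs n r s\<close> is the set \<open>\<G>\<^sub>2\<^sub>n(2r+1, 2s+1)\<close>; \<open>k\<close> is determined by \<open>r\<close> and \<open>s\<close>.\<close>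

definition merged_graphs :: "nat \<Rightarrow> nat \<Rightarrow> nat \<Rightarrow> vertex set graph set" where
  "merged_graphs n r s =
     {merge (base_graph k n) (merge_classes k n P) | k P.
        2*k+1 = (2*r+1) * (2*s+1) \<and>
        (\<forall>j\<in>{1..2*n}. admissible_partition k n r s j (P j))}"

end

theory Submission
  imports Defs
begin

text \<open>Every merged graph contains a triangle \<open>u\<^sub>i v\<^sub>i x\<close>, so every local antimagic labeling has at
  least three induced labels. Conversely, merging is injective on edges, so the labeling of the base
  graph transfers, and the label of a merged vertex is the sum of the labels of its members. Hence all
  \<open>u\<^sub>i\<close> share one label, all \<open>v\<^sub>i\<close> share another, and every merged vertex gets the block sum
  \<open>(2s+1) D\<close> with \<open>D = (4k+3) + n (8k+4)\<close>; neither of the first two is a multiple of \<open>D\<close>.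
  For bijectivity it suffices that every label in the range is attained, since there are at most as
  many edges as labels.\<close>

section \<open>Quotient graphs and how induced labels behave under merging\<close>

text \<open>\<open>cl\<close> plays the quotient map, and its first assumption forces distinct
  classes to be disjoint. Writing the merged edges as an image under \<open>cl\<close> allows sums
  over them to be reindexed by edges of \<open>G\<close>.\<close>

lemma edges_merge:
  fixes G :: "'a graph" and C :: "'a set set" and cl :: "'a \<Rightarrow> 'a set"
  assumes cl: "\<And>B v. B \<in> C \<Longrightarrow> v \<in> B \<Longrightarrow> cl v = B"
    and edge: "\<And>e. e \<in> edges G \<Longrightarrow> \<exists>a b. e = {a, b} \<and> cl a \<noteq> cl b
                  \<and> cl a \<in> C \<and> cl b \<in> C \<and> a \<in> cl a \<and> b \<in> cl b"
  shows "edges (merge G C) = (`) cl ` edges G" (is "?L = ?R")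
proof
  show "?L \<subseteq> ?R"
  proof
    fix x assume "x \<in> ?L"
    then obtain B D a b where "x = {B, D}" "B \<in> C" "D \<in> C" "a \<in> B" "b \<in> D" "{a, b} \<in> edges G"
      by (auto simp: merge_def)
    then show "x \<in> ?R" using cl by (intro image_eqI[of _ _ "{a, b}"]) auto
  qed
  show "?R \<subseteq> ?L"
  proof
    fix x assume "x \<in> ?R"
    then obtain e where e: "e \<in> edges G" "x = cl ` e" by auto
    from edge[OF e(1)] obtain a b where "e = {a, b}" "cl a \<in> C" "cl b \<in> C" "a \<in> cl a" "b \<in> cl b"
      by auto
    then show "x \<in> ?L" using e unfolding merge_def by auto
  qed
qed

text \<open>By \<open>inj\<close> no two edges collapse, so the merged edges at \<open>A\<close>
  correspond to the edges of \<open>G\<close> that meet \<open>A\<close>. Each of these meets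
  \<open>A\<close> in a single vertex, since its endpoints lie in different classes; grouping by
  that vertex gives the sum.\<close>

lemma induced_label_merge:
  fixes G :: "'a graph" and C :: "'a set set" and cl :: "'a \<Rightarrow> 'a set"
  assumes cl: "\<And>B v. B \<in> C \<Longrightarrow> v \<in> B \<Longrightarrow> cl v = B"
    and edge: "\<And>e. e \<in> edges G \<Longrightarrow> \<exists>a b. e = {a, b} \<and> cl a \<noteq> cl b
                  \<and> cl a \<in> C \<and> cl b \<in> C \<and> a \<in> cl a \<and> b \<in> cl b"
    and inj: "inj_on ((`) cl) (edges G)"
    and g: "\<And>e. e \<in> edges G \<Longrightarrow> g (cl ` e) = f e"
    and fin: "finite (edges G)" "finite A"
    and A: "A \<in> C"
  shows "induced_label (merge G C) g A = (\<Sum>v\<in>A. induced_label G f v)"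
proof -
  have E: "edges (merge G C) = (`) cl ` edges G"
    by (rule edges_merge[OF cl edge])
  have set_eq: "{e \<in> edges (merge G C). A \<in> e} = (`) cl ` {e \<in> edges G. e \<inter> A \<noteq> {}}"
  proof -
    have "A \<in> cl ` e \<longleftrightarrow> e \<inter> A \<noteq> {}" if "e \<in> edges G" for e
      using edge[OF that] cl A by auto
    then have "{e \<in> edges G. A \<in> cl ` e} = {e \<in> edges G. e \<inter> A \<noteq> {}}" by blast
    moreover have "{e \<in> (`) cl ` edges G. A \<in> e} = (`) cl ` {e \<in> edges G. A \<in> cl ` e}" by blast
    ultimately show ?thesis unfolding E by simp
  qed
  have "induced_label (merge G C) g A = sum g ((`) cl ` {e \<in> edges G. e \<inter> A \<noteq> {}})"
    unfolding induced_label_def set_eq ..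
  also have "\<dots> = (\<Sum>e\<in>{e \<in> edges G. e \<inter> A \<noteq> {}}. g (cl ` e))"
    by (subst sum.reindex) (auto intro: inj_on_subset[OF inj])
  also have "\<dots> = (\<Sum>e\<in>{e \<in> edges G. e \<inter> A \<noteq> {}}. f e)"
    by (intro sum.cong) (auto simp: g)
  also have "{e \<in> edges G. e \<inter> A \<noteq> {}} = (\<Union>v\<in>A. {e \<in> edges G. v \<in> e})"
    by auto
  also have "sum f \<dots> = (\<Sum>v\<in>A. \<Sum>e\<in>{e \<in> edges G. v \<in> e}. f e)"
  proof (intro sum.UNION_disjoint ballI impI)
    fix v w assume vw: "v \<in> A" "w \<in> A" "v \<noteq> w"
    \<comment> \<open>An edge through both \<open>v\<close> and \<open>w\<close> would have both
      endpoints in the class \<open>A\<close>.\<close>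
    have "\<not> (v \<in> e \<and> w \<in> e)" if "e \<in> edges G" for e
      using edge[OF that] cl[OF A] vw by auto
    then show "{e \<in> edges G. v \<in> e} \<inter> {e \<in> edges G. w \<in> e} = {}" by auto
  qed (use fin in auto)
  finally show "induced_label (merge G C) g A = (\<Sum>v\<in>A. induced_label G f v)"
    unfolding induced_label_def .
qed

section \<open>The lower bound from a triangle\<close>

lemma card_induced_labels_ge_3_of_triangle:
  assumes "finite (verts G)" "{a, b, c} \<subseteq> verts G"
    and "{a, b} \<in> edges G" "{a, c} \<in> edges G" "{b, c} \<in> edges G"
    and "local_antimagic G f"
  shows "3 \<le> card (induced_label G f ` verts G)"
proof -
  let ?l = "induced_label G f"
  have "card {?l a, ?l b, ?l c} = 3"
    using assms(3-6) by (auto simp: local_antimagic_def)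
  moreover have "{?l a, ?l b, ?l c} \<subseteq> ?l ` verts G" using assms(2) by auto
  ultimately show ?thesis by (metis card_mono assms(1) finite_imageI)
qed

section \<open>Well-definedness of the labeling of the base graph\<close>

text \<open>With \<open>m = (2n+2-j) div 2\<close> for the edges at \<open>u\<^sub>i\<close> and \<open>m = (j+1) div 2\<close> for those at
  \<open>v\<^sub>i\<close>, the value \<open>m\<close> is the parameter \<open>j\<close> of the corresponding rule of \<open>base_label\<close>,
  and \<open>m = 1\<close> covers the exceptional columns.\<close>

definition u_label :: "nat \<Rightarrow> nat \<Rightarrow> nat \<Rightarrow> nat \<Rightarrow> int" where
  "u_label k n i j = (let m = (2*n+2-j) div 2; c = int m * (8 * int k + 4) in
     if odd j then
       if m = 1 then (if i \<le> k+1 then 10 * int k + 7 else 12 * int k + 8) - 2 * int i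
       else (if i \<le> k+1 then int k + 2 else 3 * int k + 3) - int i + c
     else
       if m = 1 then (if i \<le> k+1 then 5 * int k + 2 else 3 * int k + 1) + int i
       else (if i \<le> k+1 then - 3 * int k - 2 else - 5 * int k - 3) + int i + c)"

definition v_label :: "nat \<Rightarrow> nat \<Rightarrow> nat \<Rightarrow> int" where
  "v_label k i j = (let m = (j+1) div 2; c = int m * (8 * int k + 4) in
     if odd j then
       if m = 1 then (if i \<le> k+1 then 3 * int k + 1 else int k) + int i
       else (if i \<le> k+1 then - 5 * int k - 3 else - 7 * int k - 4) + int i + c
     else
       if m = 1 then (if i \<le> k+1 then 8 * int k + 6 else 10 * int k + 7) - 2 * int i
       else (if i \<le> k+1 then - int k + 1 else int k + 2) - int i + c)"

text \<open>One closed formula per kind of edge reduces uniqueness of the label to nine comparisons,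
  instead of one for each pair of the seventeen rules.\<close>

lemma base_label_explicit:
  assumes "n \<ge> 2" "base_label k n e l"
  shows "(\<exists>i. e = {U i, V i} \<and> l = int i) \<or>
         (\<exists>i j. e = {U i, X i j} \<and> l = u_label k n i j) \<or>
         (\<exists>i j. e = {V i, X i j} \<and> l = v_label k i j)"
  using assms(2)
proof cases
  case (ux_odd i j)
  \<comment> \<open>As \<open>j \<le> n\<close>, the truncated subtraction is exact and the
    numerator is \<open>2*j+1\<close>, so halving recovers \<open>j\<close>; then
    \<open>j \<ge> 2\<close> selects the branch \<open>m \<noteq> 1\<close>.\<close>
  then have "(2*n+2-(2*n-2*j+1)) div 2 = j" "odd (2*n-2*j+1)" by auto
  then have "l = u_label k n i (2*n-2*j+1)" using ux_odd by (simp add: u_label_def)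
  then show ?thesis using ux_odd by blast
next
  case (ux_even i j)
  then have "(2*n+2-(2*n-2*j+2)) div 2 = j" "even (2*n-2*j+2)" by auto
  then have "l = u_label k n i (2*n-2*j+2)" using ux_even by (simp add: u_label_def)
  then show ?thesis using ux_even by blast
next
  case (ux_odd' i j)
  then have "(2*n+2-(2*n-2*j+1)) div 2 = j" "odd (2*n-2*j+1)" by auto
  then have "l = u_label k n i (2*n-2*j+1)" using ux_odd' by (simp add: u_label_def)
  then show ?thesis using ux_odd' by blast
next
  case (ux_even' i j)
  then have "(2*n+2-(2*n-2*j+2)) div 2 = j" "even (2*n-2*j+2)" by auto
  then have "l = u_label k n i (2*n-2*j+2)" using ux_even' by (simp add: u_label_def)
  then show ?thesis using ux_even' by blast
next
  case (ux_penult i)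
  have "(2*n+2-(2*n-1)) div 2 = 1" "odd (2*n-1)" using assms(1) by auto
  then have "l = u_label k n i (2*n-1)" using ux_penult by (simp add: u_label_def)
  then show ?thesis using ux_penult by blast
next
  case (ux_penult' i)
  have "(2*n+2-(2*n-1)) div 2 = 1" "odd (2*n-1)" using assms(1) by auto
  then have "l = u_label k n i (2*n-1)" using ux_penult' by (simp add: u_label_def)
  then show ?thesis using ux_penult' by blast
next
  case (ux_last i)
  then have "l = u_label k n i (2*n)" by (simp add: u_label_def)
  then show ?thesis using ux_last by blast
next
  case (ux_last' i)
  then have "l = u_label k n i (2*n)" by (simp add: u_label_def)
  then show ?thesis using ux_last' by blast
next
  case (vx_odd i j)
  then have "(2*j-1+1) div 2 = j" "odd (2*j-1)" by auto
  then have "l = v_label k i (2*j-1)" using vx_odd unfolding v_label_def Let_def by simp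
  then show ?thesis using vx_odd by blast
next
  case (vx_odd' i j)
  then have "(2*j-1+1) div 2 = j" "odd (2*j-1)" by auto
  then have "l = v_label k i (2*j-1)" using vx_odd' unfolding v_label_def Let_def by simp
  then show ?thesis using vx_odd' by blast
next
  case (vx_even i j)
  then have "l = v_label k i (2*j)" by (simp add: v_label_def)
  then show ?thesis using vx_even by blast
next
  case (vx_even' i j)
  then have "l = v_label k i (2*j)" by (simp add: v_label_def)
  then show ?thesis using vx_even' by blast
next
  case (vx_first i)
  then have "l = v_label k i 1" by (simp add: v_label_def)
  then show ?thesis using vx_first by blast
next
  case (vx_first' i)
  then have "l = v_label k i 1" by (simp add: v_label_def)
  then show ?thesis using vx_first' by blast
next
  case (vx_second i)
  then have "l = v_label k i 2" by (simp add: v_label_def)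
  then show ?thesis using vx_second by blast
next
  case (vx_second' i)
  then have "l = v_label k i 2" by (simp add: v_label_def)
  then show ?thesis using vx_second' by blast
qed auto

lemma base_label_unique:
  assumes "n \<ge> 2" "base_label k n e l" "base_label k n e l'"
  shows "l = l'"
  using base_label_explicit[OF assms(1,2)] base_label_explicit[OF assms(1,3)]
  by (elim disjE exE conjE) (simp_all add: doubleton_eq_iff)

text \<open>Ensures that \<open>nat\<close> in \<open>base_labeling\<close> loses nothing. In the
  rules with a parameter \<open>j\<close>, the bound \<open>j \<ge> 2\<close> makes the last term at
  least \<open>16k+8\<close>, which outweighs every negative offset.\<close>

lemma base_label_nonneg:
  assumes "base_label k n e l"
  shows "0 \<le> l"
proof -
  have *: "2 * (8 * int k + 4) \<le> int j * (8 * int k + 4)" if "j \<in> {2..n}" for j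
    using that by (intro mult_right_mono) auto
  from assms show ?thesis
    by cases ((drule *)?, simp)+
qed

lemma base_labeling_eq:
  assumes "n \<ge> 2" "base_label k n e l"
  shows "int (base_labeling k n e) = l"
proof -
  have "(THE l. base_label k n e l) = l"
    using assms base_label_unique by blast
  then show ?thesis using base_label_nonneg[OF assms(2)] by (simp add: base_labeling_def)
qed

section \<open>Bijectivity of the labeling of the base graph\<close>

lemma base_graph_edge_iff:
  "e \<in> edges (base_graph k n) \<longleftrightarrow>
     (\<exists>i\<in>{1..2*k+1}. e = {U i, V i}) \<or>
     (\<exists>i\<in>{1..2*k+1}. \<exists>j\<in>{1..2*n}. e = {U i, X i j}) \<or>
     (\<exists>i\<in>{1..2*k+1}. \<exists>j\<in>{1..2*n}. e = {V i, X i j})"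
  unfolding base_graph_def snd_conv by blast

lemma base_graph_edge_simps:
  "{U i, V i} \<in> edges (base_graph k n) \<longleftrightarrow> i \<in> {1..2*k+1}"
  "{U i, X i j} \<in> edges (base_graph k n) \<longleftrightarrow> i \<in> {1..2*k+1} \<and> j \<in> {1..2*n}"
  "{V i, X i j} \<in> edges (base_graph k n) \<longleftrightarrow> i \<in> {1..2*k+1} \<and> j \<in> {1..2*n}"
  by (auto simp: base_graph_edge_iff doubleton_eq_iff)

lemma base_label_edge:
  assumes "n \<ge> 2" "base_label k n e l"
  shows "e \<in> edges (base_graph k n)"
  using assms(2) by cases (use assms(1) in \<open>auto simp: base_graph_edge_simps\<close>)

text \<open>The rules tile the range of labels. The edges \<open>u_i v_i\<close> and the four
  exceptional columns fill \<open>[1, 10k+5]\<close>; above that, each \<open>j\<close> from 2 to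
  \<open>n\<close> fills one block of \<open>8k+4\<close> consecutive labels. In every case the
  witness \<open>i\<close> comes from inverting the affine formula of the rule.\<close>

lemma base_label_surj:
  assumes n: "n \<ge> 2" and l: "1 \<le> l" "l \<le> (4 * int n + 1) * (2 * int k + 1)"
  shows "\<exists>e. base_label k n e l"
proof (cases "l \<le> 10 * int k + 5")
  case True
  \<comment> \<open>One case for each rule without a parameter \<open>j\<close>. The rules with the
    term \<open>-2i\<close> have interleaved values, so these are separated by parity.\<close>
  consider "l \<le> 2*int k+1" | "2*int k+2 \<le> l" "l \<le> 3*int k+1" | "3*int k+2 \<le> l" "l \<le> 4*int k+2"
    | "4*int k+3 \<le> l" "l \<le> 5*int k+2" | "5*int k+3 \<le> l" "l \<le> 6*int k+3"
    | "6*int k+4 \<le> l" "l \<le> 8*int k+4" "even l" | "6*int k+4 \<le> l" "l \<le> 8*int k+4" "odd l"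
    | "8*int k+5 \<le> l" "even l" | "8*int k+5 \<le> l" "odd l"
    by linarith
  then show ?thesis
  proof cases
    case 1
    then show ?thesis using base_label.uv[of "nat l" k n] l by (auto simp: nat_le_iff le_nat_iff)
  next
    case 2
    then show ?thesis using base_label.vx_first'[of "nat (l - int k)" k n] by (auto simp: nat_le_iff le_nat_iff)
  next
    case 3
    then show ?thesis using base_label.vx_first[of "nat (l - 3*int k - 1)" k n] by (auto simp: nat_le_iff le_nat_iff)
  next
    case 4
    then show ?thesis using base_label.ux_last'[of "nat (l - 3*int k - 1)" k n] by (auto simp: nat_le_iff le_nat_iff)
  next
    case 5
    then show ?thesis using base_label.ux_last[of "nat (l - 5*int k - 2)" k n] by (auto simp: nat_le_iff le_nat_iff)
  next
    case 6
    then obtain t where "l = 2 * t" by auto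
    then show ?thesis using 6 base_label.vx_second[of "nat (4*int k + 3 - t)" k n] by (auto simp: nat_le_iff le_nat_iff)
  next
    case 7
    then obtain t where "l = 2 * t + 1" by (auto elim: oddE)
    then show ?thesis using 7 base_label.vx_second'[of "nat (5*int k + 3 - t)" k n] by (auto simp: add.commute nat_le_iff le_nat_iff)
  next
    case 8
    then obtain t where "l = 2 * t" by auto
    then show ?thesis using 8 True base_label.ux_penult'[of "nat (6*int k + 4 - t)" k n] by (auto simp: nat_le_iff le_nat_iff)
  next
    case 9
    then obtain t where "l = 2 * t + 1" by (auto elim: oddE)
    then show ?thesis using 9 True base_label.ux_penult[of "nat (5*int k + 3 - t)" k n] by (auto simp: add.commute nat_le_iff le_nat_iff)
  qed
next
  case False
  define M where "M = 8 * int k + 4"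
  define q where "q = (l - (10 * int k + 6)) div M"
  \<comment> \<open>The block for \<open>j\<close> starts at
    \<open>10k+6 + (j-2) M = j M - 6k - 2\<close>, so this shift makes
    \<open>c = l - j M\<close>.\<close>
  define c where "c = (l - (10 * int k + 6)) mod M - 6 * int k - 2"
  define j where "j = nat (q + 2)"
  have M: "M > 0" by (simp add: M_def)
  have q0: "0 \<le> q" using False M by (simp add: q_def pos_imp_zdiv_nonneg_iff)
  have c: "- 6 * int k - 2 \<le> c" "c \<le> 2 * int k + 1"
    using pos_mod_bound[OF M, of "l - (10 * int k + 6)"] pos_mod_sign[OF M, of "l - (10 * int k + 6)"]
    unfolding c_def M_def by linarith+
  have "q * M + (c + 6 * int k + 2) = l - (10 * int k + 6)"
    by (simp add: q_def c_def)
  then have lq: "l = c + (q + 2) * M" by (simp add: M_def algebra_simps)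
  then have lj: "l = c + int j * (8 * int k + 4)" using q0 by (simp add: j_def M_def)
  \<comment> \<open>The largest label is \<open>n M + 2k + 1\<close> and \<open>-c\<close> is at
    most \<open>6k+2\<close>. The total slack \<open>8k+3\<close> is one less than \<open>M\<close>,
    which just excludes \<open>j = n+1\<close>.\<close>
  have "(q + 2) * M \<le> int n * M + (2 * int k + 1) + (6 * int k + 2)"
    using l(2) lq c by (simp add: M_def algebra_simps)
  also have "\<dots> < (int n + 1) * M" by (simp add: M_def algebra_simps)
  finally have "q + 2 < int n + 1" using M by (simp add: mult_less_cancel_right)
  then have j: "j \<in> {2..n}" using q0 by (auto simp: j_def)
  \<comment> \<open>The offsets of the eight rules with a parameter \<open>j\<close> tile
    \<open>[-6k-2, 2k+1]\<close> by these eight intervals.\<close>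
  consider "c \<le> -5*int k-3" | "-5*int k-2 \<le> c" "c \<le> -4*int k-2" | "-4*int k-1 \<le> c" "c \<le> -3*int k-2"
    | "-3*int k-1 \<le> c" "c \<le> -2*int k-1" | "-2*int k \<le> c" "c \<le> -int k" | "-int k+1 \<le> c" "c \<le> 0"
    | "1 \<le> c" "c \<le> int k+1" | "int k+2 \<le> c"
    by linarith
  then show ?thesis
  proof cases
    case 1
    then show ?thesis using c base_label.vx_odd'[of "nat (c + 7*int k + 4)" k j n] j by (auto simp: lj nat_le_iff le_nat_iff)
  next
    case 2
    then show ?thesis using c base_label.vx_odd[of "nat (c + 5*int k + 3)" k j n] j by (auto simp: lj nat_le_iff le_nat_iff)
  next
    case 3
    then show ?thesis using c base_label.ux_even'[of "nat (c + 5*int k + 3)" k j n] j by (auto simp: lj nat_le_iff le_nat_iff)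
  next
    case 4
    then show ?thesis using c base_label.ux_even[of "nat (c + 3*int k + 2)" k j n] j by (auto simp: lj nat_le_iff le_nat_iff)
  next
    case 5
    then show ?thesis using c base_label.vx_even[of "nat (1 - int k - c)" k j n] j by (auto simp: lj nat_le_iff le_nat_iff)
  next
    case 6
    then show ?thesis using c base_label.vx_even'[of "nat (int k + 2 - c)" k j n] j by (auto simp: lj nat_le_iff le_nat_iff)
  next
    case 7
    then show ?thesis using c base_label.ux_odd[of "nat (int k + 2 - c)" k j n] j by (auto simp: lj nat_le_iff le_nat_iff)
  next
    case 8
    then show ?thesis using c base_label.ux_odd'[of "nat (3*int k + 3 - c)" k j n] j by (auto simp: lj nat_le_iff le_nat_iff)
  qed
qed

lemma base_graph_edges_image:
  "edges (base_graph k n) = (\<lambda>i. {U i, V i}) ` {1..2*k+1} \<union>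
     (\<Union>i\<in>{1..2*k+1}. (\<lambda>j. {U i, X i j}) ` {1..2*n} \<union> (\<lambda>j. {V i, X i j}) ` {1..2*n})"
  unfolding base_graph_def snd_conv by blast

lemma finite_base_graph_edges: "finite (edges (base_graph k n))"
  unfolding base_graph_edges_image by auto

text \<open>Union bounds suffice here, without any disjointness argument; equality follows later
  from surjectivity of the labeling.\<close>

lemma card_base_graph_edges_le: "card (edges (base_graph k n)) \<le> (4*n+1) * (2*k+1)"
proof -
  let ?I = "{1..2*k+1}"
  let ?A = "\<lambda>i. (\<lambda>j. {U i, X i j}) ` {1..2*n}" and ?B = "\<lambda>i. (\<lambda>j. {V i, X i j}) ` {1..2*n}"
  have "card (?A i \<union> ?B i) \<le> 4 * n" for i
    using card_Un_le[of "?A i" "?B i"] card_image_le[of "{1..2*n}" "\<lambda>j. {U i, X i j}"]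
      card_image_le[of "{1..2*n}" "\<lambda>j. {V i, X i j}"] by simp
  then have "(\<Sum>i\<in>?I. card (?A i \<union> ?B i)) \<le> card ?I * (4 * n)"
    using sum_bounded_above[of ?I "\<lambda>i. card (?A i \<union> ?B i)" "4 * n"] by simp
  then have "card (\<Union>i\<in>?I. ?A i \<union> ?B i) \<le> card ?I * (4 * n)"
    using card_UN_le[of ?I "\<lambda>i. ?A i \<union> ?B i"] by simp
  moreover have "card ((\<lambda>i. {U i, V i}) ` ?I) \<le> card ?I" by (rule card_image_le) simp
  ultimately have "card (edges (base_graph k n)) \<le> card ?I + card ?I * (4 * n)"
    unfolding base_graph_edges_image by (meson card_Un_le add_mono le_trans)
  also have "\<dots> = (4*n+1) * (2*k+1)" by (simp add: algebra_simps)
  finally show ?thesis .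
qed

lemma bij_betw_base_labeling:
  assumes "n \<ge> 2"
  shows "bij_betw (base_labeling k n) (edges (base_graph k n)) {1..(4*n+1) * (2*k+1)}"
    and "card (edges (base_graph k n)) = (4*n+1) * (2*k+1)"
proof -
  let ?f = "base_labeling k n" and ?E = "edges (base_graph k n)" and ?N = "(4*n+1) * (2*k+1)"
  have sub: "{1..?N} \<subseteq> ?f ` ?E"
  proof
    fix l assume "l \<in> {1..?N}"
    then have "1 \<le> int l" "int l \<le> int ?N" unfolding of_nat_le_iff by auto
    moreover have "int ?N = (4 * int n + 1) * (2 * int k + 1)" by (simp add: algebra_simps)
    ultimately obtain e where e: "base_label k n e (int l)"
      using base_label_surj[OF assms, of "int l" k] by metis
    then show "l \<in> ?f ` ?E"
      using base_labeling_eq[OF assms e] base_label_edge[OF assms e] by (intro image_eqI[of _ _ e]) auto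
  qed
  note fin = finite_base_graph_edges[of k n]
  have "?N \<le> card (?f ` ?E)" using card_mono[OF finite_imageI[OF fin] sub] by simp
  then have card: "card (?f ` ?E) = ?N" "card ?E = ?N"
    using card_image_le[OF fin, of ?f] card_base_graph_edges_le[of k n] by linarith+
  have "?f ` ?E = {1..?N}"
    using card_subset_eq[OF finite_imageI[OF fin] sub] card(1) by simp
  then show "bij_betw ?f ?E {1..?N}"
    using eq_card_imp_inj_on[OF fin, of ?f] card by (simp add: bij_betw_def)
  show "card ?E = ?N" by (fact card(2))
qed

section \<open>Induced labels of the vertices \<open>u_i\<close> and \<open>v_i\<close>\<close>

lemma sum_pairs_up: "(\<Sum>j=1..2*n. g j) = (\<Sum>j=1..n. g (2*j-1) + g (2*j))" for g :: "nat \<Rightarrow> nat"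
  by (induction n) (auto simp: add.assoc)

text \<open>The rules at \<open>u_i\<close> number the pairs of columns from the right, so that
  \<open>j = 1\<close> is the exceptional pair \<open>2n-1\<close>, \<open>2n\<close>.\<close>

lemma sum_pairs_down:
  "(\<Sum>j=1..2*n. g j) = (\<Sum>j=1..n. g (2*n-2*j+1) + g (2*n-2*j+2))" for g :: "nat \<Rightarrow> nat"
proof -
  have "(\<Sum>j=1..2*n. g j) = (\<Sum>j=1..n. g (2*j-1) + g (2*j))" by (fact sum_pairs_up)
  also have "\<dots> = (\<Sum>j=1..n. g (2*(n+1-j)-1) + g (2*(n+1-j)))"
    by (rule sum.atLeastAtMost_rev)
  also have "\<dots> = (\<Sum>j=1..n. g (2*n-2*j+1) + g (2*n-2*j+2))"
  proof (intro sum.cong refl)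
    fix j assume "j \<in> {1..n}"
    then have "2*(n+1-j)-1 = 2*n-2*j+1" "2*(n+1-j) = 2*n-2*j+2" by auto
    then show "g (2*(n+1-j)-1) + g (2*(n+1-j)) = g (2*n-2*j+1) + g (2*n-2*j+2)" by simp
  qed
  finally show ?thesis .
qed

lemma sum_arith_from_2:
  "(\<Sum>j\<in>{2..n}. c + 2 * int j * M) = (int n - 1) * c + (int n * (int n + 1) - 2) * M" if "n \<ge> 1"
  using that by (induction n rule: dec_induct) (auto simp: algebra_simps)

text \<open>In each pair of columns with \<open>j \<ge> 2\<close> the two labels depend on
  \<open>i\<close> with opposite signs. The exceptional pair leaves \<open>-i\<close>, which cancels
  the label \<open>i\<close> of the edge \<open>u_i v_i\<close>.\<close>

lemma induced_label_U:
  assumes n: "n \<ge> 2" and i: "i \<in> {1..2*k+1}"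
  shows "induced_label (base_graph k n) (base_labeling k n) (U i)
           = 8*n^2*k + 6*n*k + 4*n^2 + 4*n + k + 1"
proof -
  let ?f = "base_labeling k n"
  have "{e \<in> edges (base_graph k n). U i \<in> e} = insert {U i, V i} ((\<lambda>j. {U i, X i j}) ` {1..2*n})"
    using i by (auto simp: base_graph_edge_iff)
  moreover have "{U i, V i} \<notin> (\<lambda>j. {U i, X i j}) ` {1..2*n}" by (auto simp: doubleton_eq_iff)
  moreover have "inj_on (\<lambda>j. {U i, X i j}) {1..2*n}" by (auto simp: inj_on_def doubleton_eq_iff)
  ultimately have "induced_label (base_graph k n) ?f (U i)
      = ?f {U i, V i} + (\<Sum>j=1..2*n. ?f {U i, X i j})"
    by (simp add: induced_label_def sum.reindex)
  also have "\<dots> = ?f {U i, V i} + (\<Sum>j=1..n. ?f {U i, X i (2*n-2*j+1)} + ?f {U i, X i (2*n-2*j+2)})"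
    by (simp only: sum_pairs_down)
  also have "{1..n} = insert 1 {2..n}" using n by auto
  also have "(\<Sum>j\<in>\<dots>. ?f {U i, X i (2*n-2*j+1)} + ?f {U i, X i (2*n-2*j+2)})
      = ?f {U i, X i (2*n-1)} + ?f {U i, X i (2*n)}
      + (\<Sum>j\<in>{2..n}. ?f {U i, X i (2*n-2*j+1)} + ?f {U i, X i (2*n-2*j+2)})"
    using n by (simp add: Suc_diff_Suc numeral_2_eq_2)
  finally have *: "int (induced_label (base_graph k n) ?f (U i)) =
      int (?f {U i, V i}) + (int (?f {U i, X i (2*n-1)}) + int (?f {U i, X i (2*n)}))
      + (\<Sum>j\<in>{2..n}. int (?f {U i, X i (2*n-2*j+1)}) + int (?f {U i, X i (2*n-2*j+2)}))"
    by simp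
  note eq = base_labeling_eq[OF n, of k]
  \<comment> \<open>For both ranges of \<open>i\<close> the exceptional pair sums to
    \<open>15k+9-i\<close>, and every other pair to \<open>-2k + 2j(8k+4)\<close>.\<close>
  have "int (induced_label (base_graph k n) ?f (U i))
      = int i + (15 * int k + 9 - int i)
      + (\<Sum>j\<in>{2..n}. - 2 * int k + 2 * int j * (8 * int k + 4))"
  proof (cases "i \<le> k+1")
    case True
    then have i': "i \<in> {1..k+1}" using i by auto
    have "(\<Sum>j\<in>{2..n}. int (?f {U i, X i (2*n-2*j+1)}) + int (?f {U i, X i (2*n-2*j+2)})) = (\<Sum>j\<in>{2..n}. - 2 * int k + 2 * int j * (8 * int k + 4))"
      by (intro sum.cong refl)
        (simp only: eq[OF base_label.ux_odd[OF i']] eq[OF base_label.ux_even[OF i']]; simp)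
    then show ?thesis
      unfolding * eq[OF base_label.uv[OF i]] eq[OF base_label.ux_penult[OF i']] eq[OF base_label.ux_last[OF i']]
      by simp
  next
    case False
    then have i': "i \<in> {k+2..2*k+1}" using i by auto
    have "(\<Sum>j\<in>{2..n}. int (?f {U i, X i (2*n-2*j+1)}) + int (?f {U i, X i (2*n-2*j+2)})) = (\<Sum>j\<in>{2..n}. - 2 * int k + 2 * int j * (8 * int k + 4))"
      by (intro sum.cong refl)
        (simp only: eq[OF base_label.ux_odd'[OF i']] eq[OF base_label.ux_even'[OF i']]; simp)
    then show ?thesis
      unfolding * eq[OF base_label.uv[OF i]] eq[OF base_label.ux_penult'[OF i']] eq[OF base_label.ux_last'[OF i']]
      by simp
  qed
  also have "\<dots> = int (8*n^2*k + 6*n*k + 4*n^2 + 4*n + k + 1)"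
    using n by (subst sum_arith_from_2) (auto simp: algebra_simps power2_eq_square)
  finally show ?thesis by (simp only: of_nat_eq_iff)
qed

lemma induced_label_V:
  assumes n: "n \<ge> 2" and i: "i \<in> {1..2*k+1}"
  shows "induced_label (base_graph k n) (base_labeling k n) (V i)
           = 8*n^2*k + 2*n*k + 4*n^2 + 2*n + k + 1"
proof -
  let ?f = "base_labeling k n"
  have "{e \<in> edges (base_graph k n). V i \<in> e} = insert {U i, V i} ((\<lambda>j. {V i, X i j}) ` {1..2*n})"
    using i by (auto simp: base_graph_edge_iff)
  moreover have "{U i, V i} \<notin> (\<lambda>j. {V i, X i j}) ` {1..2*n}" by (auto simp: doubleton_eq_iff)
  moreover have "inj_on (\<lambda>j. {V i, X i j}) {1..2*n}" by (auto simp: inj_on_def doubleton_eq_iff)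
  ultimately have "induced_label (base_graph k n) ?f (V i)
      = ?f {U i, V i} + (\<Sum>j=1..2*n. ?f {V i, X i j})"
    by (simp add: induced_label_def sum.reindex)
  also have "\<dots> = ?f {U i, V i} + (\<Sum>j=1..n. ?f {V i, X i (2*j-1)} + ?f {V i, X i (2*j)})"
    by (simp only: sum_pairs_up)
  also have "{1..n} = insert 1 {2..n}" using n by auto
  also have "(\<Sum>j\<in>\<dots>. ?f {V i, X i (2*j-1)} + ?f {V i, X i (2*j)})
      = ?f {V i, X i 1} + ?f {V i, X i 2}
      + (\<Sum>j\<in>{2..n}. ?f {V i, X i (2*j-1)} + ?f {V i, X i (2*j)})"
    by simp
  finally have *: "int (induced_label (base_graph k n) ?f (V i)) =
      int (?f {U i, V i}) + (int (?f {V i, X i 1}) + int (?f {V i, X i 2}))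
      + (\<Sum>j\<in>{2..n}. int (?f {V i, X i (2*j-1)}) + int (?f {V i, X i (2*j)}))"
    by simp
  note eq = base_labeling_eq[OF n, of k]
  \<comment> \<open>The same cancellation as at \<open>u_i\<close>, now with exceptional sum
    \<open>11k+7-i\<close> from columns 1 and 2.\<close>
  have "int (induced_label (base_graph k n) ?f (V i))
      = int i + (11 * int k + 7 - int i)
      + (\<Sum>j\<in>{2..n}. (- 6 * int k - 2) + 2 * int j * (8 * int k + 4))"
  proof (cases "i \<le> k+1")
    case True
    then have i': "i \<in> {1..k+1}" using i by auto
    have "(\<Sum>j\<in>{2..n}. int (?f {V i, X i (2*j-1)}) + int (?f {V i, X i (2*j)})) = (\<Sum>j\<in>{2..n}. (- 6 * int k - 2) + 2 * int j * (8 * int k + 4))"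
      by (intro sum.cong refl)
        (simp only: eq[OF base_label.vx_odd[OF i']] eq[OF base_label.vx_even[OF i']]; simp)
    then show ?thesis
      unfolding * eq[OF base_label.uv[OF i]] eq[OF base_label.vx_first[OF i']] eq[OF base_label.vx_second[OF i']]
      by simp
  next
    case False
    then have i': "i \<in> {k+2..2*k+1}" using i by auto
    have "(\<Sum>j\<in>{2..n}. int (?f {V i, X i (2*j-1)}) + int (?f {V i, X i (2*j)})) = (\<Sum>j\<in>{2..n}. (- 6 * int k - 2) + 2 * int j * (8 * int k + 4))"
      by (intro sum.cong refl)
        (simp only: eq[OF base_label.vx_odd'[OF i']] eq[OF base_label.vx_even'[OF i']]; simp)
    then show ?thesis
      unfolding * eq[OF base_label.uv[OF i]] eq[OF base_label.vx_first'[OF i']] eq[OF base_label.vx_second'[OF i']]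
      by simp
  qed
  also have "\<dots> = int (8*n^2*k + 2*n*k + 4*n^2 + 2*n + k + 1)"
    using n by (subst sum_arith_from_2) (auto simp: algebra_simps power2_eq_square)
  finally show ?thesis by (simp only: of_nat_eq_iff)
qed

section \<open>Separating the three labels\<close>

text \<open>With \<open>D = (4k+3) + n (8k+4)\<close>, the label of \<open>u\<^sub>i\<close> lies strictly between \<open>n D\<close> and
  \<open>(n+1) D\<close>, and that of \<open>v\<^sub>i\<close> strictly between \<open>(n-1) D\<close> and \<open>n D\<close>.\<close>

lemma U_label_not_multiple:
  "m * ((4*k+3) + n * (8*k+4)) \<noteq> 8*n^2*k + 6*n*k + 4*n^2 + 4*n + k + (1::nat)"
proof
  let ?D = "(4*k+3) + n * (8*k+4)"
  assume eq: "m * ?D = 8*n^2*k + 6*n*k + 4*n^2 + 4*n + k + 1"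
  have "n * ?D < m * ?D" unfolding eq by (simp add: algebra_simps power2_eq_square)
  moreover have "m * ?D < (n + 1) * ?D" unfolding eq by (simp add: algebra_simps power2_eq_square)
  ultimately show False unfolding mult_less_cancel2 by linarith
qed

lemma V_label_not_multiple:
  assumes "n \<ge> 2"
  shows "m * ((4*k+3) + n * (8*k+4)) \<noteq> 8*n^2*k + 2*n*k + 4*n^2 + 2*n + k + (1::nat)"
proof
  let ?D = "(4*k+3) + n * (8*k+4)"
  assume eq: "m * ?D = 8*n^2*k + 2*n*k + 4*n^2 + 2*n + k + 1"
  \<comment> \<open>The margin below \<open>n * ?D\<close> is \<open>2nk + n - k - 1\<close>; this
    substitution turns it into \<open>2pk + 3k + p + 1\<close>, visibly positive.\<close>
  obtain p where "n = p + 2" using assms by (metis add.commute le_Suc_ex)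
  then have "m * ?D < n * ?D" unfolding eq by (simp add: algebra_simps power2_eq_square)
  \<comment> \<open>The lower bound by \<open>(n-1) * ?D\<close>, with one \<open>?D\<close> moved
    across to avoid natural subtraction.\<close>
  moreover have "n * ?D < (m + 1) * ?D"
    unfolding distrib_right eq by (simp add: algebra_simps power2_eq_square)
  ultimately show False unfolding mult_less_cancel2 by linarith
qed

section \<open>Transfer to the merged graph and the value of \<open>chi_la\<close>\<close>

theorem theorem2p4:
  fixes n r s :: nat and G :: "vertex set graph"
  assumes "n \<ge> 2" and "r \<ge> 1" and "s \<ge> 1"
    and "G \<in> merged_graphs n r s"
  shows "chi_la G = 3"
proof -
  from assms(4) obtain k P where G: "G = merge (base_graph k n) (merge_classes k n P)"
    and adm: "\<And>j. j \<in> {1..2*n} \<Longrightarrow> admissible_partition k n r s j (P j)"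
    unfolding merged_graphs_def by blast
  note n = assms(1)
  let ?B = "base_graph k n" and ?C = "merge_classes k n P" and ?f = "base_labeling k n"
    and ?N = "(4*n+1) * (2*k+1)" and ?I = "{1..2*k+1}" and ?J = "{1..2*n}"
  define a where "a = 8*n^2*k + 6*n*k + 4*n^2 + 4*n + k + 1"
  define b where "b = 8*n^2*k + 2*n*k + 4*n^2 + 2*n + k + 1"
  define d where "d = (2*s+1) * ((4*k+3) + n * (8*k+4))"
  have part: "partition_on ?I (P j)" if "j \<in> ?J" for j
    using adm[OF that] by (simp add: admissible_partition_def)
  define block where "block i j = (THE A. A \<in> P j \<and> i \<in> A)" for i j
  have block_eq: "block i j = A" if "j \<in> ?J" "A \<in> P j" "i \<in> A" for i j A
    unfolding block_def using partition_onD2[OF part[OF that(1)]] that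
    by (intro the_equality) (auto simp: disjoint_def)
  have block: "block i j \<in> P j" "i \<in> block i j" if j: "j \<in> ?J" and i: "i \<in> ?I" for i j
  proof -
    obtain A where "A \<in> P j" "i \<in> A" using partition_onD1[OF part[OF j]] i by blast
    then show "block i j \<in> P j" "i \<in> block i j" using block_eq[OF j] by auto
  qed
  define cl where "cl v = (case v of U i \<Rightarrow> {U i} | V i \<Rightarrow> {V i} | X i j \<Rightarrow> (\<lambda>i. X i j) ` block i j)" for v
  have cl_simps: "cl (U i) = {U i}" "cl (V i) = {V i}" "cl (X i j) = (\<lambda>i. X i j) ` block i j" for i j
    by (simp_all add: cl_def)
  have cl_UV: "cl (U i) \<in> ?C" "cl (V i) \<in> ?C" if "i \<in> ?I" for i
    using that unfolding cl_simps merge_classes_def by blast+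
  have cl_X: "cl (X i j) \<in> ?C" "X i j \<in> cl (X i j)" if "i \<in> ?I" "j \<in> ?J" for i j
    using that block unfolding cl_simps merge_classes_def by blast+
  have cl_eq: "cl v = A" if "A \<in> ?C" "v \<in> A" for A v
    using that block_eq by (auto simp: cl_simps merge_classes_def)
  \<comment> \<open>Valid for all indices, even where \<open>block\<close> is unspecified, because
    an image under \<open>X i j\<close> contains no \<open>U\<close> or \<open>V\<close>.\<close>
  have XU: "cl (X i j) \<noteq> {U i'}" "cl (X i j) \<noteq> {V i'}" for i j i'
    by (auto simp: cl_simps)
  have XX: "j = j'" if "cl (X i j) = cl (X i' j')" "i \<in> ?I" "j \<in> ?J" for i j i' j'
    using that block(2)[of j i] by (auto simp: cl_simps)
  have edge: "\<exists>x y. e = {x, y} \<and> cl x \<noteq> cl y \<and> cl x \<in> ?C \<and> cl y \<in> ?C \<and> x \<in> cl x \<and> y \<in> cl y"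
    if "e \<in> edges ?B" for e
    using that unfolding base_graph_edge_iff
  proof (elim disjE bexE)
    fix i assume "i \<in> ?I" "e = {U i, V i}"
    then show ?thesis
      using cl_UV[of i] by (intro exI[of _ "U i"] exI[of _ "V i"]) (simp add: cl_simps)
  next
    fix i j assume "i \<in> ?I" "j \<in> ?J" "e = {U i, X i j}"
    then show ?thesis
      using cl_UV[of i] cl_X[of i j] XU(1)[of i j i]
      by (intro exI[of _ "U i"] exI[of _ "X i j"]) (simp add: cl_simps(1,2))
  next
    fix i j assume "i \<in> ?I" "j \<in> ?J" "e = {V i, X i j}"
    then show ?thesis
      using cl_UV[of i] cl_X[of i j] XU(2)[of i j i]
      by (intro exI[of _ "V i"] exI[of _ "X i j"]) (simp add: cl_simps(1,2))
  qed
  \<comment> \<open>Merging forgets only the first index of an \<open>X\<close>. The other endpoint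
    of the edge is a \<open>U\<close> or \<open>V\<close> with a singleton class, which still
    reveals \<open>i\<close>, while \<open>XX\<close> recovers the column \<open>j\<close>.\<close>
  have inj: "inj_on ((`) cl) (edges ?B)"
  proof (rule inj_onI)
    fix e e' assume "e \<in> edges ?B" "e' \<in> edges ?B" "cl ` e = cl ` e'"
    then show "e = e'"
      unfolding base_graph_edge_iff
      by (elim disjE bexE; simp add: doubleton_eq_iff cl_simps(1,2) XU XU[symmetric])
        (use XX in \<open>metis atLeastAtMost_iff One_nat_def Suc_eq_plus1\<close>)+
  qed
  define g where "g e = ?f (the_inv_into (edges ?B) ((`) cl) e)" for e
  have g: "g (cl ` e) = ?f e" if "e \<in> edges ?B" for e
    unfolding g_def by (simp add: the_inv_into_f_f[OF inj that])
  have finblock: "finite A" if "j \<in> ?J" "A \<in> P j" for j A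
    using partition_onD1[OF part[OF that(1)]] that
    by (metis Union_upper finite_atLeastAtMost finite_subset)
  have finC: "finite A" if "A \<in> ?C" for A
    using that finblock by (auto simp: merge_classes_def)
  have EG: "edges G = (`) cl ` edges ?B"
    unfolding G by (rule edges_merge[OF cl_eq edge])
  have VG: "verts G = ?C" by (simp add: G merge_def)
  have lab: "induced_label G g A = (\<Sum>v\<in>A. induced_label ?B ?f v)" if "A \<in> ?C" for A
    unfolding G by (rule induced_label_merge[where cl = cl and f = ?f,
          OF cl_eq edge inj g finite_base_graph_edges finC[OF that] that])
  have labU: "induced_label G g {U i} = a" if "i \<in> ?I" for i
    using lab[of "{U i}"] that induced_label_U[OF n that] by (auto simp: merge_classes_def a_def)
  have labV: "induced_label G g {V i} = b" if "i \<in> ?I" for i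
    using lab[of "{V i}"] that induced_label_V[OF n that] by (auto simp: merge_classes_def b_def)
  have labX: "induced_label G g ((\<lambda>i. X i j) ` A) = d" if "j \<in> ?J" "A \<in> P j" for j A
  proof -
    have "(\<lambda>i. X i j) ` A \<in> ?C" using that by (auto simp: merge_classes_def)
    then have "induced_label G g ((\<lambda>i. X i j) ` A) = (\<Sum>i\<in>A. induced_label ?B ?f (X i j))"
      by (subst lab) (simp_all add: sum.reindex inj_on_def)
    also have "\<dots> = d" using adm[OF that(1)] that(2) by (simp add: admissible_partition_def d_def)
    finally show ?thesis .
  qed
  \<comment> \<open>\<open>d\<close> is a multiple of \<open>(4k+3) + n(8k+4)\<close> while
    \<open>a\<close> and \<open>b\<close> are not, and \<open>a - b = 4nk + 2n\<close> is
    positive.\<close>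
  have distinct: "a \<noteq> b" "a \<noteq> d" "b \<noteq> d"
    using n U_label_not_multiple[of "2*s+1" k n] V_label_not_multiple[OF n, of "2*s+1" k]
    unfolding a_def b_def d_def by auto
  have labcl: "induced_label G g (cl (X i j)) = d" if "i \<in> ?I" "j \<in> ?J" for i j
    using labX block(1) that by (simp add: cl_simps)
  have la: "local_antimagic G g"
    unfolding local_antimagic_def
  proof (intro conjI allI impI)
    have "bij_betw ((`) cl) (edges ?B) (edges G)" using inj EG by (simp add: bij_betw_def)
    moreover have "bij_betw (g \<circ> (`) cl) (edges ?B) {1..?N}"
      using bij_betw_base_labeling(1)[OF n, of k] by (subst bij_betw_cong[of _ _ ?f]) (simp_all add: g)
    ultimately have "bij_betw g (edges G) {1..?N}" using bij_betw_comp_iff by blast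
    moreover have "card (edges G) = ?N"
      using bij_betw_base_labeling(2)[OF n, of k] by (simp add: EG card_image[OF inj])
    ultimately show "bij_betw g (edges G) {1..card (edges G)}" by simp
  next
    fix A B assume "{A, B} \<in> edges G"
    then obtain e where "e \<in> edges ?B" "{A, B} = cl ` e" unfolding EG by auto
    then show "induced_label G g A \<noteq> induced_label G g B"
      unfolding base_graph_edge_iff using distinct
      by (elim disjE bexE) (auto simp: doubleton_eq_iff cl_simps(1,2) labU labV labcl)
  qed
  have finV: "finite (verts G)"
  proof -
    have "?C \<subseteq> Pow (verts ?B)"
      using partition_onD1[OF part] by (fastforce simp: merge_classes_def base_graph_def)
    moreover have "verts ?B = U ` ?I \<union> V ` ?I \<union> (\<lambda>(i, j). X i j) ` (?I \<times> ?J)"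
      by (auto simp: base_graph_def)
    ultimately show ?thesis unfolding VG by (simp add: finite_subset)
  qed
  have "\<exists>A B D. {A, B, D} \<subseteq> verts G \<and> {A, B} \<in> edges G \<and> {A, D} \<in> edges G \<and> {B, D} \<in> edges G"
  proof -
    have "{cl (U 1), cl (V 1), cl (X 1 1)} \<subseteq> verts G"
      using cl_UV[of 1] cl_X[of 1 1] n VG by auto
    moreover have "{U 1, V 1} \<in> edges ?B" "{U 1, X 1 1} \<in> edges ?B" "{V 1, X 1 1} \<in> edges ?B"
      using n by (auto simp: base_graph_edge_simps)
    then have "cl ` {U 1, V 1} \<in> edges G" "cl ` {U 1, X 1 1} \<in> edges G" "cl ` {V 1, X 1 1} \<in> edges G"
      unfolding EG by blast+
    ultimately show ?thesis by auto
  qed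
  then have lower: "3 \<le> card (induced_label G h ` verts G)" if "local_antimagic G h" for h
    using card_induced_labels_ge_3_of_triangle[OF finV _ _ _ _ that] by blast
  have "induced_label G g ` verts G \<subseteq> {a, b, d}"
    unfolding VG using labU labV labX by (auto simp: merge_classes_def)
  then have "card (induced_label G g ` verts G) \<le> card {a, b, d}" by (intro card_mono) auto
  also have "\<dots> = 3" using distinct by simp
  finally have "card (induced_label G g ` verts G) = 3" using lower[OF la] by simp
  then show ?thesis
    unfolding chi_la_def using la lower by (intro cInf_eq_minimum) force+
qed

end
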